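(* Let $\Sigma_1=(X_1,X_{1,0},S_1,U,\to_1,Y,h_1)$ and $\Sigma_2=(X_2,X_{2,0},S_2,U,\to_2,Y,h_2)$ be NTSs with common input set $U$ and output set $Y$. Suppose there exists an InitSOP simulation relation $\sim\subseteq X_1\times X_2$ from $\Sigma_1$ to $\Sigma_2$. If $\Sigma_1$ is initial-state opaque, then $\Sigma_2$ is initial-state opaque.
   Context: A nondeterministic transition system (NTS) is a tuple $\Sigma=(X,X_0,S,U,\to,Y,h)$, where $X$ is a (possibly infinite) set of states, $X_0\subseteq X$ the initial states, $S\subseteq X$ the secret states, $U$ a (possibly infinite) set of inputs, $\to\subseteq X\times U\times X$ the transition relation (write $x\xrightarrow{u}x'$ for $(x,u,x')\in\to$), $Y$ a set of outputs and $h:X\to Y$ the output map. $U^*$ is the set of finite sequences $\alpha=\alpha(0)\cdots\alpha(|\alpha|-1)$ over $U$, including the empty one. For $\alpha\in U^*$, a run over $\alpha$ is a nonempty sequence of states $x_0x_1\dots x_k$ with $k\le|\alpha|$, $x_0\in X_0$ and $(x_j,\alpha(j),x_{j+1})\in\to$ for all $j\in\{0,\dots,k-1\}$; it is maximal if $k=|\alpha|$ or there is no $x'$ with $(x_k,\alpha(k),x')\in\to$. $\Sigma$ is initial-state opaque if for every $\alpha\in U^*$ and every maximal run $x_0\dots x_k$ over $\alpha$ with $x_0\in X_0\cap S$, there is a maximal run $x_0'\dots x_k'$ over $\alpha$ with $x_0'\notin S$ and $h(x_j)=h(x_j')$ for all $j\in\{0,\dots,k\}$. A relation $\sim\subseteq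 X_1\times X_2$ is an InitSOP (initial-state opacity-preserving) simulation relation from $\Sigma_1$ to $\Sigma_2$ if: (1a) for every $x_{1,0}\in X_{1,0}\setminus S_1$ there is $x_{2,0}\in X_{2,0}\setminus S_2$ with $(x_{1,0},x_{2,0})\in\sim$; (1b) for every $x_{2,0}\in X_{2,0}\cap S_2$ there is $x_{1,0}\in X_{1,0}\cap S_1$ with $(x_{1,0},x_{2,0})\in\sim$; (2) $h_1(x_1)=h_2(x_2)$ for all $(x_1,x_2)\in\sim$; (3a) for every $(x_1,x_2)\in\sim$ and every transition $x_1\xrightarrow{u}_1x_1'$ there is a transition $x_2\xrightarrow{u}_2x_2'$ (same input $u$) with $(x_1',x_2')\in\sim$; (3b) for every $(x_1,x_2)\in\sim$ and every transition $x_2\xrightarrow{u}_2x_2'$ there is a transition $x_1\xrightarrow{u}_1x_1'$ with $(x_1',x_2')\in\sim$. *)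

theory Defs
  imports Main "HOL-Library.FuncSet"
begin

record ('x, 'u, 'y) nts =
  states :: "'x set"
  initial :: "'x set"
  secret :: "'x set"
  inputs :: "'u set"
  trans_rel :: "('x \<times> 'u \<times> 'x) set"
  outputs :: "'y set"
  output_map :: "'x \<Rightarrow> 'y"

definition is_nts :: "('x, 'u, 'y) nts \<Rightarrow> bool" where
  "is_nts \<Sigma> \<longleftrightarrow>
     initial \<Sigma> \<subseteq> states \<Sigma> \<and>
     secret \<Sigma> \<subseteq> states \<Sigma> \<and>
     trans_rel \<Sigma> \<subseteq> states \<Sigma> \<times> inputs \<Sigma> \<times> states \<Sigma> \<and>
     output_map \<Sigma> \<in> states \<Sigma> \<rightarrow> outputs \<Sigma>"

text \<open>A run \<open>x\<^sub>0 x\<^sub>1 \<dots> x\<^sub>k\<close> is the list of its states, so \<open>k\<close> is \<open>length xs - 1\<close>.\<close>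

definition run_over :: "('x, 'u, 'y) nts \<Rightarrow> 'u list \<Rightarrow> 'x list \<Rightarrow> bool" where
  "run_over \<Sigma> \<alpha> xs \<longleftrightarrow>
     xs \<noteq> [] \<and>
     set xs \<subseteq> states \<Sigma> \<and>
     length xs - 1 \<le> length \<alpha> \<and>
     xs ! 0 \<in> initial \<Sigma> \<and>
     (\<forall>j < length xs - 1. (xs ! j, \<alpha> ! j, xs ! Suc j) \<in> trans_rel \<Sigma>)"

definition maximal_run_over :: "('x, 'u, 'y) nts \<Rightarrow> 'u list \<Rightarrow> 'x list \<Rightarrow> bool" where
  "maximal_run_over \<Sigma> \<alpha> xs \<longleftrightarrow>
     run_over \<Sigma> \<alpha> xs \<and>
     (let k = length xs - 1 in
        k = length \<alpha> \<or> (\<nexists>x'. (xs ! k, \<alpha> ! k, x') \<in> trans_rel \<Sigma>))"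

definition initial_state_opaque :: "('x, 'u, 'y) nts \<Rightarrow> bool" where
  "initial_state_opaque \<Sigma> \<longleftrightarrow>
     (\<forall>\<alpha> \<in> lists (inputs \<Sigma>). \<forall>xs.
        maximal_run_over \<Sigma> \<alpha> xs \<and> xs ! 0 \<in> initial \<Sigma> \<inter> secret \<Sigma> \<longrightarrow>
        (\<exists>xs'. maximal_run_over \<Sigma> \<alpha> xs' \<and>
               length xs' = length xs \<and>
               xs' ! 0 \<notin> secret \<Sigma> \<and>
               (\<forall>j < length xs. output_map \<Sigma> (xs ! j) = output_map \<Sigma> (xs' ! j))))"

definition InitSOP_simulation ::
    "('x1, 'u, 'y) nts \<Rightarrow> ('x2, 'u, 'y) nts \<Rightarrow> ('x1 \<times> 'x2) set \<Rightarrow> bool" where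
  "InitSOP_simulation \<Sigma>\<^sub>1 \<Sigma>\<^sub>2 R \<longleftrightarrow>
     R \<subseteq> states \<Sigma>\<^sub>1 \<times> states \<Sigma>\<^sub>2 \<and>
     (\<forall>x1 \<in> initial \<Sigma>\<^sub>1 - secret \<Sigma>\<^sub>1. \<exists>x2 \<in> initial \<Sigma>\<^sub>2 - secret \<Sigma>\<^sub>2. (x1, x2) \<in> R) \<and>
     (\<forall>x2 \<in> initial \<Sigma>\<^sub>2 \<inter> secret \<Sigma>\<^sub>2. \<exists>x1 \<in> initial \<Sigma>\<^sub>1 \<inter> secret \<Sigma>\<^sub>1. (x1, x2) \<in> R) \<and>
     (\<forall>(x1, x2) \<in> R. output_map \<Sigma>\<^sub>1 x1 = output_map \<Sigma>\<^sub>2 x2) \<and>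
     (\<forall>(x1, x2) \<in> R. \<forall>u x1'. (x1, u, x1') \<in> trans_rel \<Sigma>\<^sub>1 \<longrightarrow>
        (\<exists>x2'. (x2, u, x2') \<in> trans_rel \<Sigma>\<^sub>2 \<and> (x1', x2') \<in> R)) \<and>
     (\<forall>(x1, x2) \<in> R. \<forall>u x2'. (x2, u, x2') \<in> trans_rel \<Sigma>\<^sub>2 \<longrightarrow>
        (\<exists>x1'. (x1, u, x1') \<in> trans_rel \<Sigma>\<^sub>1 \<and> (x1', x2') \<in> R))"

end

theory Submission
  imports Defs
begin

text \<open>
  Conditions (3a) and (3b) make an InitSOP simulation relation a strong bisimulation, so it transports
  runs in both directions. Since related states also enable the same inputs, maximality is
  transported too. A secret maximal run of \<open>\<Sigma>\<^sub>2\<close> is pulled back to \<open>\<Sigma>\<^sub>1\<close>, replaced there by a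
  non-secret one with the same outputs, and the latter is pushed forward to \<open>\<Sigma>\<^sub>2\<close>.
\<close>

text \<open>Keeps the conditions that are symmetric in the two systems and drops (1a) and (1b),
  which are not. A single lifting lemma can then be applied both to \<open>R\<close> and to its
  converse.\<close>

definition bisimulation ::
    "('x1, 'u, 'y) nts \<Rightarrow> ('x2, 'u, 'y) nts \<Rightarrow> ('x1 \<times> 'x2) set \<Rightarrow> bool" where
  "bisimulation \<Sigma>\<^sub>1 \<Sigma>\<^sub>2 R \<longleftrightarrow>
     R \<subseteq> states \<Sigma>\<^sub>1 \<times> states \<Sigma>\<^sub>2 \<and>
     (\<forall>(x1, x2) \<in> R. output_map \<Sigma>\<^sub>1 x1 = output_map \<Sigma>\<^sub>2 x2) \<and>
     (\<forall>(x1, x2) \<in> R. \<forall>u x1'. (x1, u, x1') \<in> trans_rel \<Sigma>\<^sub>1 \<longrightarrow>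
        (\<exists>x2'. (x2, u, x2') \<in> trans_rel \<Sigma>\<^sub>2 \<and> (x1', x2') \<in> R)) \<and>
     (\<forall>(x1, x2) \<in> R. \<forall>u x2'. (x2, u, x2') \<in> trans_rel \<Sigma>\<^sub>2 \<longrightarrow>
        (\<exists>x1'. (x1, u, x1') \<in> trans_rel \<Sigma>\<^sub>1 \<and> (x1', x2') \<in> R))"

lemma bisimulation_converse:
  "bisimulation \<Sigma>\<^sub>1 \<Sigma>\<^sub>2 R \<Longrightarrow> bisimulation \<Sigma>\<^sub>2 \<Sigma>\<^sub>1 (R\<inverse>)"
  unfolding bisimulation_def by fastforce

lemma InitSOP_simulation_imp_bisimulation:
  "InitSOP_simulation \<Sigma>\<^sub>1 \<Sigma>\<^sub>2 R \<Longrightarrow> bisimulation \<Sigma>\<^sub>1 \<Sigma>\<^sub>2 R"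
  unfolding InitSOP_simulation_def bisimulation_def by blast

text \<open>The lifted path is built from left to right, each transition being answered from the
  pair reached so far. Induction at the end of the list leaves the indices into
  \<open>\<alpha>\<close> unshifted, so \<open>\<alpha>\<close> can stay fixed.\<close>

lemma simulation_lift_path:
  assumes step: "\<And>x y u x'. (x, y) \<in> R \<Longrightarrow> (x, u, x') \<in> T\<^sub>1 \<Longrightarrow> \<exists>y'. (y, u, y') \<in> T\<^sub>2 \<and> (x', y') \<in> R"
    and "xs \<noteq> []" and "(xs ! 0, y) \<in> R"
    and "\<forall>j < length xs - 1. (xs ! j, \<alpha> ! j, xs ! Suc j) \<in> T\<^sub>1"
  shows "\<exists>ys. length ys = length xs \<and> ys ! 0 = y \<and> (\<forall>j < length xs. (xs ! j, ys ! j) \<in> R) \<and>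
    (\<forall>j < length xs - 1. (ys ! j, \<alpha> ! j, ys ! Suc j) \<in> T\<^sub>2)"
  using assms(2-)
proof (induction xs rule: rev_nonempty_induct)
  case (single x)
  then show ?case by (intro exI[of _ "[y]"]) simp
next
  case (snoc x xs)
  have xs0: "(xs @ [x]) ! 0 = xs ! 0" and pos: "0 < length xs"
    using snoc.hyps by (simp_all add: nth_append)
  \<comment> \<open>Below this bound both \<open>j\<close> and \<open>Suc j\<close> are positions of
    \<open>xs\<close>, so the appended state does not interfere.\<close>
  have path: "(xs ! j, \<alpha> ! j, xs ! Suc j) \<in> T\<^sub>1" if "j < length xs - 1" for j
  proof -
    from that have "j < length xs" "Suc j < length xs" by linarith+
    then show ?thesis using snoc.prems(2)[rule_format, of j] by (simp add: nth_append)
  qed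
  with snoc.IH snoc.prems(1) xs0 obtain ys where ys: "length ys = length xs" "ys ! 0 = y"
      "\<forall>j < length xs. (xs ! j, ys ! j) \<in> R"
      "\<forall>j < length xs - 1. (ys ! j, \<alpha> ! j, ys ! Suc j) \<in> T\<^sub>2"
    by auto
  \<comment> \<open>The last position of \<open>xs\<close>: the transition to the new state
    \<open>x\<close> leaves from here and reads \<open>\<alpha> ! k\<close>.\<close>
  define k where "k = length xs - 1"
  have k: "length xs = Suc k" using pos by (simp add: k_def)
  have "(xs ! k, \<alpha> ! k, x) \<in> T\<^sub>1"
    using snoc.prems(2)[rule_format, of k] k by (simp add: nth_append)
  then obtain y' where y': "(ys ! k, \<alpha> ! k, y') \<in> T\<^sub>2" "(x, y') \<in> R"
    using step[of "xs ! k" "ys ! k" "\<alpha> ! k" x] ys(3) k by auto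
  show ?case
    using ys y' k by (intro exI[of _ "ys @ [y']"]) (auto simp: nth_append less_Suc_eq)
qed

text \<open>The forward condition lifts the path, and the backward condition makes the lifted run
  maximal.\<close>

lemma bisimulation_lift_maximal_run:
  assumes bisim: "bisimulation \<Sigma>\<^sub>1 \<Sigma>\<^sub>2 R"
    and run: "maximal_run_over \<Sigma>\<^sub>1 \<alpha> xs"
    and y: "(xs ! 0, y) \<in> R" "y \<in> initial \<Sigma>\<^sub>2"
  obtains ys where "maximal_run_over \<Sigma>\<^sub>2 \<alpha> ys" "length ys = length xs" "ys ! 0 = y"
    "\<forall>j < length xs. output_map \<Sigma>\<^sub>1 (xs ! j) = output_map \<Sigma>\<^sub>2 (ys ! j)"
proof -
  have xs: "xs \<noteq> []" "length xs - 1 \<le> length \<alpha>"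
      "\<forall>j < length xs - 1. (xs ! j, \<alpha> ! j, xs ! Suc j) \<in> trans_rel \<Sigma>\<^sub>1"
    and max: "length xs - 1 = length \<alpha> \<or>
      (\<nexists>x'. (xs ! (length xs - 1), \<alpha> ! (length xs - 1), x') \<in> trans_rel \<Sigma>\<^sub>1)"
    using run by (auto simp: maximal_run_over_def run_over_def Let_def)
  have forth: "\<And>x y u x'. (x, y) \<in> R \<Longrightarrow> (x, u, x') \<in> trans_rel \<Sigma>\<^sub>1 \<Longrightarrow>
      \<exists>y'. (y, u, y') \<in> trans_rel \<Sigma>\<^sub>2 \<and> (x', y') \<in> R"
    using bisim unfolding bisimulation_def by blast
  obtain ys where ys: "length ys = length xs" "ys ! 0 = y"
      "\<forall>j < length xs. (xs ! j, ys ! j) \<in> R"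
      "\<forall>j < length xs - 1. (ys ! j, \<alpha> ! j, ys ! Suc j) \<in> trans_rel \<Sigma>\<^sub>2"
    using simulation_lift_path[of R "trans_rel \<Sigma>\<^sub>1" "trans_rel \<Sigma>\<^sub>2", OF _ xs(1) y(1) xs(3)] forth by blast
  have "set ys \<subseteq> states \<Sigma>\<^sub>2"
    using bisim ys(1,3) unfolding bisimulation_def by (fastforce simp: in_set_conv_nth)
  then have "run_over \<Sigma>\<^sub>2 \<alpha> ys"
    using xs(1,2) ys(1,2,4) y(2) by (auto simp: run_over_def)
  moreover have "(xs ! (length xs - 1), ys ! (length xs - 1)) \<in> R"
    using ys(3) xs(1) by simp
  \<comment> \<open>If \<open>ys\<close> could move on under the next input, the backward condition
    at the related end states would let \<open>xs\<close> move on as well.\<close>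
  then have "length xs - 1 = length \<alpha> \<or>
      (\<nexists>y'. (ys ! (length xs - 1), \<alpha> ! (length xs - 1), y') \<in> trans_rel \<Sigma>\<^sub>2)"
    using max bisim unfolding bisimulation_def by blast
  ultimately have "maximal_run_over \<Sigma>\<^sub>2 \<alpha> ys"
    using ys(1) by (simp add: maximal_run_over_def Let_def)
  moreover have "\<forall>j < length xs. output_map \<Sigma>\<^sub>1 (xs ! j) = output_map \<Sigma>\<^sub>2 (ys ! j)"
    using bisim ys(3) unfolding bisimulation_def by blast
  ultimately show thesis using that ys(1,2) by blast
qed

theorem theorem3p7:
  fixes \<Sigma>\<^sub>1 :: "('x1, 'u, 'y) nts" and \<Sigma>\<^sub>2 :: "('x2, 'u, 'y) nts"
  assumes "is_nts \<Sigma>\<^sub>1" and "is_nts \<Sigma>\<^sub>2"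
    and "inputs \<Sigma>\<^sub>1 = inputs \<Sigma>\<^sub>2" and "outputs \<Sigma>\<^sub>1 = outputs \<Sigma>\<^sub>2"
    and "\<exists>R. InitSOP_simulation \<Sigma>\<^sub>1 \<Sigma>\<^sub>2 R"
    and "initial_state_opaque \<Sigma>\<^sub>1"
  shows "initial_state_opaque \<Sigma>\<^sub>2"
  unfolding initial_state_opaque_def
proof (intro ballI allI impI, elim conjE)
  fix \<alpha> ys
  assume \<alpha>: "\<alpha> \<in> lists (inputs \<Sigma>\<^sub>2)" and ys: "maximal_run_over \<Sigma>\<^sub>2 \<alpha> ys"
    and ys0: "ys ! 0 \<in> initial \<Sigma>\<^sub>2 \<inter> secret \<Sigma>\<^sub>2"
  obtain R where R: "InitSOP_simulation \<Sigma>\<^sub>1 \<Sigma>\<^sub>2 R" using assms(5) by blast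
  note bisim = InitSOP_simulation_imp_bisimulation[OF R]
  \<comment> \<open>Condition (1b) supplies the secret start for the pulled-back run.\<close>
  obtain x where x: "x \<in> initial \<Sigma>\<^sub>1 \<inter> secret \<Sigma>\<^sub>1" "(x, ys ! 0) \<in> R"
    using R ys0 unfolding InitSOP_simulation_def by blast
  then have "(ys ! 0, x) \<in> R\<inverse>" "x \<in> initial \<Sigma>\<^sub>1" by auto
  then obtain xs where xs: "maximal_run_over \<Sigma>\<^sub>1 \<alpha> xs" "length xs = length ys" "xs ! 0 = x"
      "\<forall>j < length ys. output_map \<Sigma>\<^sub>2 (ys ! j) = output_map \<Sigma>\<^sub>1 (xs ! j)"
    using bisimulation_lift_maximal_run[OF bisimulation_converse[OF bisim] ys] by blast
  \<comment> \<open>Opacity of \<open>\<Sigma>\<^sub>1\<close> applies because the input sets agree,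
    so \<open>\<alpha>\<close> is also a word over its inputs.\<close>
  then obtain xs' where xs': "maximal_run_over \<Sigma>\<^sub>1 \<alpha> xs'" "length xs' = length xs"
      "xs' ! 0 \<notin> secret \<Sigma>\<^sub>1"
      "\<forall>j < length xs. output_map \<Sigma>\<^sub>1 (xs ! j) = output_map \<Sigma>\<^sub>1 (xs' ! j)"
    using assms(3,6) \<alpha> x(1) unfolding initial_state_opaque_def by metis
  then have "xs' ! 0 \<in> initial \<Sigma>\<^sub>1 - secret \<Sigma>\<^sub>1"
    by (simp add: maximal_run_over_def run_over_def)
  \<comment> \<open>Condition (1a) supplies a non-secret start for the run pushed forward.\<close>
  then obtain y where y: "y \<in> initial \<Sigma>\<^sub>2" "y \<notin> secret \<Sigma>\<^sub>2" "(xs' ! 0, y) \<in> R"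
    using R unfolding InitSOP_simulation_def by blast
  obtain ys' where "maximal_run_over \<Sigma>\<^sub>2 \<alpha> ys'" "length ys' = length xs'" "ys' ! 0 = y"
      "\<forall>j < length xs'. output_map \<Sigma>\<^sub>1 (xs' ! j) = output_map \<Sigma>\<^sub>2 (ys' ! j)"
    using bisimulation_lift_maximal_run[OF bisim xs'(1) y(3,1)] by blast
  \<comment> \<open>Equality of outputs is chained along \<open>ys\<close>, \<open>xs\<close>,
    \<open>xs'\<close>, \<open>ys'\<close>, which all have the same length.\<close>
  then show "\<exists>ys'. maximal_run_over \<Sigma>\<^sub>2 \<alpha> ys' \<and> length ys' = length ys \<and> ys' ! 0 \<notin> secret \<Sigma>\<^sub>2 \<and>
      (\<forall>j < length ys. output_map \<Sigma>\<^sub>2 (ys ! j) = output_map \<Sigma>\<^sub>2 (ys' ! j))"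
    using xs(2,4) xs'(2,4) y(2) by (intro exI[of _ ys']) simp
qed

end
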